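(* Let $\{x_{mn}\}$ be a double sequence in an intuitionistic fuzzy normed space $(X,\mu,\nu,\star,\circ)$. Then for all $r>0$, the set $\mathcal{I}_2^{(\mu,\nu)}\text{-}LIM_{x_{mn}}^r$ is closed (in the topology on $X$ induced by $(\mu,\nu)$).
   Context: $\mathcal{I}_2$ is a fixed non-trivial admissible ideal of subsets of $\mathbb{N}\times\mathbb{N}$ (that is, $\mathbb{N}\times\mathbb{N}\notin\mathcal{I}_2$ and every singleton belongs to $\mathcal{I}_2$). A continuous $t$-norm (resp. $t$-conorm) is an associative, commutative, continuous binary operation $\star$ (resp. $\circ$) on $[0,1]$, monotone in each argument, with $x\star 1=x$ (resp. $x\circ 0=x$) for all $x\in[0,1]$. An intuitionistic fuzzy normed space (IFNS) is a 5-tuple $(X,\mu,\nu,\star,\circ)$ where $X$ is a normed linear space, $\star$ is a continuous $t$-norm, $\circ$ is a continuous $t$-conorm, and $\mu,\nu:X\times(0,\infty)\to[0,1]$ satisfy for all $x,y\in X$, $s,t>0$: $\mu(x,t)+\nu(x,t)\le 1$; $\mu(x,t)>0$; $\mu(x,t)=1$ iff $x=0$; $\mu(\alpha x,t)=\mu(x,t/|\alpha|)$ for each scalar $\alpha\ne0$; $\mu(x,t)\star\mu(y,s)\le\mu(x+y,t+s)$; $\mu(x,\cdot)$ is continuous on $(0,\infty)$; $\lim_{t\to\infty}\mu(x,t)=1$, and $\lim_{t\to0}\mu(x,t)=0$ for $x\neq 0$; $\nu(x,t)<1$; $\nu(x,t)=0$ iff $x=0$; $\nu(\alpha x,t)=\nu(x,t/|\alpha|)$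 for each scalar $\alpha\neq0$; $\nu(x,t)\circ\nu(y,s)\ge\nu(x+y,s+t)$; $\nu(x,\cdot)$ is continuous on $(0,\infty)$; $\lim_{t\to\infty}\nu(x,t)=0$, and $\lim_{t\to0}\nu(x,t)=1$ for $x\ne0$. The open ball is $B(x,\lambda,t)=\{y\in X:\mu(x-y,t)>1-\lambda,\ \nu(x-y,t)<\lambda\}$ for $x\in X$, $\lambda\in(0,1)$, $t>0$. The topology induced by $(\mu,\nu)$ consists of the sets $A\subseteq X$ such that for each $x\in A$ there are $t>0$ and $\lambda\in(0,1)$ with $B(x,\lambda,t)\subseteq A$. For $r\ge0$, $\{x_{mn}\}$ is rough $\mathcal{I}_2$-convergent to $\xi\in X$ if for every $\varepsilon>0$ and $\lambda\in(0,1)$, $\{(m,n)\in\mathbb{N}\times\mathbb{N}:\mu(x_{mn}-\xi,r+\varepsilon)\le1-\lambda\text{ or }\nu(x_{mn}-\xi,r+\varepsilon)\ge\lambda\}\in\mathcal{I}_2$. $\mathcal{I}_2^{(\mu,\nu)}\text{-}LIM_{x_{mn}}^r$ is the set of all such $\xi\in X$. *)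

theory Defs
  imports "HOL-Analysis.Analysis"
begin

definition admissible_ideal :: "'i set set \<Rightarrow> bool" where
  "admissible_ideal I \<longleftrightarrow>
     {} \<in> I \<and>
     (\<forall>A B. A \<in> I \<longrightarrow> B \<in> I \<longrightarrow> A \<union> B \<in> I) \<and>
     (\<forall>A B. A \<in> I \<longrightarrow> B \<subseteq> A \<longrightarrow> B \<in> I) \<and>
     UNIV \<notin> I \<and>
     (\<forall>a. {a} \<in> I)"

text \<open>
  Continuous $t$-norms (unit $1$) and $t$-conorms (unit $0$) are operations on $[0,1]$; their
  values outside the unit square are unconstrained.
\<close>

locale continuous_unit_interval_op =
  fixes f :: "real \<Rightarrow> real \<Rightarrow> real" and e :: real
  assumes closed: "\<lbrakk>x \<in> {0..1}; y \<in> {0..1}\<rbrakk> \<Longrightarrow> f x y \<in> {0..1}"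
    and assoc: "\<lbrakk>x \<in> {0..1}; y \<in> {0..1}; z \<in> {0..1}\<rbrakk> \<Longrightarrow> f (f x y) z = f x (f y z)"
    and commute: "\<lbrakk>x \<in> {0..1}; y \<in> {0..1}\<rbrakk> \<Longrightarrow> f x y = f y x"
    and continuous: "continuous_on ({0..1} \<times> {0..1}) (\<lambda>(x, y). f x y)"
    and mono: "\<lbrakk>x \<in> {0..1}; x' \<in> {0..1}; y \<in> {0..1}; y' \<in> {0..1}; x \<le> x'; y \<le> y'\<rbrakk>
      \<Longrightarrow> f x y \<le> f x' y'"
    and unit: "x \<in> {0..1} \<Longrightarrow> f x e = x"

abbreviation continuous_t_norm :: "(real \<Rightarrow> real \<Rightarrow> real) \<Rightarrow> bool" where
  "continuous_t_norm f \<equiv> continuous_unit_interval_op f 1"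

abbreviation continuous_t_conorm :: "(real \<Rightarrow> real \<Rightarrow> real) \<Rightarrow> bool" where
  "continuous_t_conorm f \<equiv> continuous_unit_interval_op f 0"

text \<open>
  A normed linear space over a scalar field \<open>'k\<close>, where \<open>'k\<close> may be the real or the complex
  numbers. For \<open>'k = real\<close> the assumption \<open>scale_of_real\<close> forces \<open>scale = (*\<^sub>R)\<close>.
\<close>

locale normed_linear_space = vector_space scale
  for scale :: "'k::real_normed_field \<Rightarrow> 'a::real_normed_vector \<Rightarrow> 'a" +
  assumes scale_of_real: "scale (of_real c) x = c *\<^sub>R x"
    and norm_scale: "norm (scale a x) = norm a * norm x"

text \<open>
  The fuzzy norms \<open>\<mu>\<close>, \<open>\<nu>\<close> live on $X \times (0,\infty)$; their values at times
  \<open>t \<le> 0\<close> are unconstrained.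
\<close>

locale ifns = normed_linear_space scale
  for scale :: "'k::real_normed_field \<Rightarrow> 'a::real_normed_vector \<Rightarrow> 'a" +
  fixes \<mu> \<nu> :: "'a \<Rightarrow> real \<Rightarrow> real"
    and tnorm tconorm :: "real \<Rightarrow> real \<Rightarrow> real"
  assumes tnorm: "continuous_t_norm tnorm"
    and tconorm: "continuous_t_conorm tconorm"
    and mu_range: "t > 0 \<Longrightarrow> \<mu> x t \<in> {0..1}"
    and nu_range: "t > 0 \<Longrightarrow> \<nu> x t \<in> {0..1}"
    and mu_nu_le: "t > 0 \<Longrightarrow> \<mu> x t + \<nu> x t \<le> 1"
    and mu_pos: "t > 0 \<Longrightarrow> \<mu> x t > 0"
    and mu_eq_1_iff: "t > 0 \<Longrightarrow> \<mu> x t = 1 \<longleftrightarrow> x = 0"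
    and mu_scale: "\<lbrakk>t > 0; a \<noteq> 0\<rbrakk> \<Longrightarrow> \<mu> (scale a x) t = \<mu> x (t / norm a)"
    and mu_triangle: "\<lbrakk>s > 0; t > 0\<rbrakk> \<Longrightarrow> tnorm (\<mu> x t) (\<mu> y s) \<le> \<mu> (x + y) (t + s)"
    and mu_continuous: "continuous_on {0<..} (\<mu> x)"
    and mu_at_top: "(\<mu> x \<longlongrightarrow> 1) at_top"
    and mu_at_0: "x \<noteq> 0 \<Longrightarrow> (\<mu> x \<longlongrightarrow> 0) (at_right 0)"
    and nu_less_1: "t > 0 \<Longrightarrow> \<nu> x t < 1"
    and nu_eq_0_iff: "t > 0 \<Longrightarrow> \<nu> x t = 0 \<longleftrightarrow> x = 0"
    and nu_scale: "\<lbrakk>t > 0; a \<noteq> 0\<rbrakk> \<Longrightarrow> \<nu> (scale a x) t = \<nu> x (t / norm a)"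
    and nu_triangle: "\<lbrakk>s > 0; t > 0\<rbrakk> \<Longrightarrow> tconorm (\<nu> x t) (\<nu> y s) \<ge> \<nu> (x + y) (s + t)"
    and nu_continuous: "continuous_on {0<..} (\<nu> x)"
    and nu_at_top: "(\<nu> x \<longlongrightarrow> 0) at_top"
    and nu_at_0: "x \<noteq> 0 \<Longrightarrow> (\<nu> x \<longlongrightarrow> 1) (at_right 0)"

definition ifns_ball ::
    "('a::real_normed_vector \<Rightarrow> real \<Rightarrow> real) \<Rightarrow> ('a \<Rightarrow> real \<Rightarrow> real) \<Rightarrow> 'a \<Rightarrow> real \<Rightarrow> real \<Rightarrow> 'a set" where
  "ifns_ball \<mu> \<nu> x l t = {y. \<mu> (x - y) t > 1 - l \<and> \<nu> (x - y) t < l}"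

definition ifns_open ::
    "('a::real_normed_vector \<Rightarrow> real \<Rightarrow> real) \<Rightarrow> ('a \<Rightarrow> real \<Rightarrow> real) \<Rightarrow> 'a set \<Rightarrow> bool" where
  "ifns_open \<mu> \<nu> A \<longleftrightarrow> (\<forall>x\<in>A. \<exists>t>0. \<exists>l\<in>{0<..<1}. ifns_ball \<mu> \<nu> x l t \<subseteq> A)"

text \<open>
  In general \<^const>\<open>topology\<close> is only meaningful on predicates satisfying \<^const>\<open>istopology\<close>;
  lemma \<open>openin_ifns_topology\<close> below shows that this is the case here.
\<close>

definition ifns_topology ::
    "('a::real_normed_vector \<Rightarrow> real \<Rightarrow> real) \<Rightarrow> ('a \<Rightarrow> real \<Rightarrow> real) \<Rightarrow> 'a topology" where
  "ifns_topology \<mu> \<nu> = topology (ifns_open \<mu> \<nu>)"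

context ifns
begin

lemma mu_mono:
  assumes "0 < s" "s \<le> t" shows "\<mu> x s \<le> \<mu> x t"
proof (cases "s = t")
  case False
  interpret T: continuous_unit_interval_op tnorm 1 by (rule tnorm)
  have "\<mu> 0 (t - s) = 1" using assms False by (simp add: mu_eq_1_iff)
  then show ?thesis
    using mu_triangle[of "t - s" s x 0] T.unit[OF mu_range[of s x]] assms False by simp
qed simp

lemma nu_antimono:
  assumes "0 < s" "s \<le> t" shows "\<nu> x t \<le> \<nu> x s"
proof (cases "s = t")
  case False
  interpret S: continuous_unit_interval_op tconorm 0 by (rule tconorm)
  have "\<nu> 0 (t - s) = 0" using assms False by (simp add: nu_eq_0_iff)
  then show ?thesis
    using nu_triangle[of "t - s" s x 0] S.unit[OF nu_range[of s x]] assms False by simp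
qed simp

lemma ifns_ball_mono:
  assumes "0 < s" "s \<le> t" "k \<le> l"
  shows "ifns_ball \<mu> \<nu> x k s \<subseteq> ifns_ball \<mu> \<nu> x l t"
proof
  fix y assume "y \<in> ifns_ball \<mu> \<nu> x k s"
  then show "y \<in> ifns_ball \<mu> \<nu> x l t"
    using mu_mono[OF assms(1,2), of "x - y"] nu_antimono[OF assms(1,2), of "x - y"] assms(3)
    by (simp add: ifns_ball_def)
qed

lemma istopology_ifns_open: "istopology (ifns_open \<mu> \<nu>)"
  unfolding istopology_def
proof (intro conjI allI impI)
  fix A B assume AB: "ifns_open \<mu> \<nu> A" "ifns_open \<mu> \<nu> B"
  show "ifns_open \<mu> \<nu> (A \<inter> B)"
    unfolding ifns_open_def
  proof
    fix x assume x: "x \<in> A \<inter> B"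
    obtain s k where s: "s > 0" "k \<in> {0<..<1}" "ifns_ball \<mu> \<nu> x k s \<subseteq> A"
      using AB(1) x unfolding ifns_open_def by blast
    obtain t l where t: "t > 0" "l \<in> {0<..<1}" "ifns_ball \<mu> \<nu> x l t \<subseteq> B"
      using AB(2) x unfolding ifns_open_def by blast
    have "ifns_ball \<mu> \<nu> x (min k l) (min s t) \<subseteq> A \<inter> B"
      using ifns_ball_mono[of "min s t" s "min k l" k x]
        ifns_ball_mono[of "min s t" t "min k l" l x] s t by auto
    moreover have "min s t > 0" "min k l \<in> {0<..<1}" using s t by auto
    ultimately show "\<exists>t>0. \<exists>l\<in>{0<..<1}. ifns_ball \<mu> \<nu> x l t \<subseteq> A \<inter> B" by blast
  qed
next
  fix K assume "\<forall>A\<in>K. ifns_open \<mu> \<nu> A"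
  then show "ifns_open \<mu> \<nu> (\<Union>K)"
    unfolding ifns_open_def by (meson Union_iff Union_upper order_trans)
qed

lemma openin_ifns_topology: "openin (ifns_topology \<mu> \<nu>) A \<longleftrightarrow> ifns_open \<mu> \<nu> A"
  by (simp add: ifns_topology_def istopology_ifns_open)

lemma topspace_ifns_topology: "topspace (ifns_topology \<mu> \<nu>) = UNIV"
proof -
  have "\<exists>t::real>0. \<exists>l::real. 0 < l \<and> l < 1"
    by (intro exI[of _ 1] exI[of _ "1/2"] conjI) auto
  then have "ifns_open \<mu> \<nu> UNIV" by (simp add: ifns_open_def Bex_def)
  then show ?thesis
    using openin_subset[of "ifns_topology \<mu> \<nu>" UNIV] openin_ifns_topology by auto
qed

end

definition rough_I2_convergent ::
    "(nat \<times> nat) set set \<Rightarrow> ('a::real_normed_vector \<Rightarrow> real \<Rightarrow> real) \<Rightarrow> ('a \<Rightarrow> real \<Rightarrow> real)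
      \<Rightarrow> real \<Rightarrow> (nat \<Rightarrow> nat \<Rightarrow> 'a) \<Rightarrow> 'a \<Rightarrow> bool" where
  "rough_I2_convergent I \<mu> \<nu> r x \<xi> \<longleftrightarrow>
     (\<forall>\<epsilon>>0. \<forall>l\<in>{0<..<1}.
        {(m, n). \<mu> (x m n - \<xi>) (r + \<epsilon>) \<le> 1 - l \<or> \<nu> (x m n - \<xi>) (r + \<epsilon>) \<ge> l} \<in> I)"

definition rough_I2_LIM ::
    "(nat \<times> nat) set set \<Rightarrow> ('a::real_normed_vector \<Rightarrow> real \<Rightarrow> real) \<Rightarrow> ('a \<Rightarrow> real \<Rightarrow> real)
      \<Rightarrow> real \<Rightarrow> (nat \<Rightarrow> nat \<Rightarrow> 'a) \<Rightarrow> 'a set" where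
  "rough_I2_LIM I \<mu> \<nu> r x = {\<xi>. rough_I2_convergent I \<mu> \<nu> r x \<xi>}"

end

theory Submission
  imports Defs
begin

text \<open>
  If \<open>\<xi>\<close> is not a rough limit, witnessed by \<open>\<epsilon>\<close> and \<open>l\<close>, then neither is any point of the ball
  around \<open>\<xi>\<close> of radius \<open>k\<close> at time \<open>\<epsilon>/2\<close>, where \<open>k\<close> is so small that
  \<open>(1 - k) \<star> (1 - k) > 1 - l\<close> and \<open>k \<circ> k < l\<close>: splitting \<open>r + \<epsilon> = (r + \<epsilon>/2) + \<epsilon>/2\<close> in the
  triangle inequalities, the exceptional set of \<open>\<xi>\<close> at \<open>(\<epsilon>, l)\<close> is contained in that of such a
  point at \<open>(\<epsilon>/2, k)\<close>. Hence the complement of the limit set is open.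
\<close>

context continuous_unit_interval_op
begin

text \<open>Continuity is available only on the closed unit square, so \<open>u\<close> must
  eventually stay in the unit interval for the limit to pass through \<open>f\<close>.\<close>

lemma tendsto_diagonal:
  assumes "(u \<longlongrightarrow> a) F" "eventually (\<lambda>s. u s \<in> {0..1}) F" "a \<in> {0..1}"
  shows "((\<lambda>s. f (u s) (u s)) \<longlongrightarrow> f a a) F"
  using continuous_on_tendsto_compose[OF continuous tendsto_Pair[OF assms(1,1)]] assms(2,3)
  by simp

end

context ifns
begin

sublocale T: continuous_unit_interval_op tnorm 1 by (rule tnorm)

sublocale S: continuous_unit_interval_op tconorm 0 by (rule tconorm)

text \<open>At \<open>k = 0\<close> the units give the values 1 and 0, so both inequalities are
  strict there; by continuity along the diagonal they persist for small
  \<open>k > 0\<close>.\<close>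

lemma ex_radius:
  assumes "l > 0"
  obtains k where "k \<in> {0<..<1}" "tnorm (1 - k) (1 - k) > 1 - l" "tconorm k k < l"
proof -
  have k: "\<forall>\<^sub>F k :: real in at_right 0. k \<in> {0<..<1}"
    by (rule eventually_at_right_real) simp
  have id: "((\<lambda>k::real. k) \<longlongrightarrow> 0) (at_right 0)" by (rule tendsto_ident_at)
  have "((\<lambda>k. 1 - k) \<longlongrightarrow> 1 - (0::real)) (at_right 0)"
    by (intro tendsto_intros)
  then have "((\<lambda>k. tnorm (1 - k) (1 - k)) \<longlongrightarrow> tnorm 1 1) (at_right 0)"
    by (intro T.tendsto_diagonal) (auto intro: eventually_mono[OF k])
  then have T: "\<forall>\<^sub>F k in at_right 0. tnorm (1 - k) (1 - k) > 1 - l"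
    by (rule order_tendstoD) (simp add: T.unit assms)
  have "((\<lambda>k. tconorm k k) \<longlongrightarrow> tconorm 0 0) (at_right 0)"
    by (intro S.tendsto_diagonal id) (auto intro: eventually_mono[OF k])
  then have S: "\<forall>\<^sub>F k in at_right 0. tconorm k k < l"
    by (rule order_tendstoD) (simp add: S.unit assms)
  show ?thesis
    using eventually_happens[OF eventually_conj[OF k eventually_conj[OF T S]]] that by auto
qed

text \<open>The scalar -1 has norm 1, so scaling by it leaves the time unchanged.\<close>

lemma mu_minus_commute: "t > 0 \<Longrightarrow> \<mu> (x - y) t = \<mu> (y - x) t"
  using mu_scale[of t "-1" "x - y"] by simp

lemma nu_minus_commute: "t > 0 \<Longrightarrow> \<nu> (x - y) t = \<nu> (y - x) t"
  using nu_scale[of t "-1" "x - y"] by simp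

lemma ifns_ball_commute: "t > 0 \<Longrightarrow> y \<in> ifns_ball \<mu> \<nu> x l t \<longleftrightarrow> x \<in> ifns_ball \<mu> \<nu> y l t"
  by (simp add: ifns_ball_def mu_minus_commute[of t x] nu_minus_commute[of t x])

text \<open>The triangle inequalities in terms of balls. Since \<open>k\<close> and
  \<open>1 - k\<close> lie in the unit interval, monotonicity of both operations bounds the combined
  values.\<close>

lemma ifns_ball_trans:
  assumes "y \<in> ifns_ball \<mu> \<nu> x k s" "z \<in> ifns_ball \<mu> \<nu> y k t"
    and "s > 0" "t > 0" "k \<in> {0<..<1}" "tnorm (1 - k) (1 - k) > 1 - l" "tconorm k k < l"
  shows "z \<in> ifns_ball \<mu> \<nu> x l (s + t)"
proof -
  have "tnorm (1 - k) (1 - k) \<le> tnorm (\<mu> (x - y) s) (\<mu> (y - z) t)"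
    using assms mu_range by (intro T.mono) (auto simp: ifns_ball_def)
  also have "\<dots> \<le> \<mu> (x - z) (s + t)"
    using mu_triangle[of t s "x - y" "y - z"] assms by simp
  finally have "\<mu> (x - z) (s + t) > 1 - l"
    using assms by simp
  moreover have "\<nu> (x - z) (s + t) \<le> tconorm (\<nu> (x - y) s) (\<nu> (y - z) t)"
    using nu_triangle[of t s "x - y" "y - z"] assms by (simp add: add.commute)
  moreover have "tconorm (\<nu> (x - y) s) (\<nu> (y - z) t) \<le> tconorm k k"
    using assms nu_range by (intro S.mono) (auto simp: ifns_ball_def)
  ultimately show ?thesis
    using assms by (simp add: ifns_ball_def)
qed

text \<open>By De Morgan, an index is exceptional exactly when the ball centred at the sequence term
  misses \<xi>.\<close>

lemma rough_I2_convergent_iff_ball: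
  "rough_I2_convergent I \<mu> \<nu> r x \<xi> \<longleftrightarrow>
    (\<forall>\<epsilon>>0. \<forall>l\<in>{0<..<1}. {(m, n). \<xi> \<notin> ifns_ball \<mu> \<nu> (x m n) l (r + \<epsilon>)} \<in> I)"
  by (simp add: rough_I2_convergent_def ifns_ball_def de_Morgan_conj not_less)

lemma closedin_rough_I2_LIM:
  assumes down: "\<And>A B. A \<in> I \<Longrightarrow> B \<subseteq> A \<Longrightarrow> B \<in> I" and "r \<ge> 0"
  shows "closedin (ifns_topology \<mu> \<nu>) (rough_I2_LIM I \<mu> \<nu> r x)"
proof -
  have "\<exists>t>0. \<exists>k\<in>{0<..<1}. ifns_ball \<mu> \<nu> \<xi> k t \<subseteq> - rough_I2_LIM I \<mu> \<nu> r x"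
    if "\<xi> \<notin> rough_I2_LIM I \<mu> \<nu> r x" for \<xi>
  proof -
    have "\<exists>\<epsilon>>0. \<exists>l\<in>{0<..<1}. {(m, n). \<xi> \<notin> ifns_ball \<mu> \<nu> (x m n) l (r + \<epsilon>)} \<notin> I"
      using that by (simp add: rough_I2_LIM_def rough_I2_convergent_iff_ball)
    then obtain \<epsilon> l where \<epsilon>: "\<epsilon> > 0" and l: "l \<in> {0<..<1}"
      and notin: "{(m, n). \<xi> \<notin> ifns_ball \<mu> \<nu> (x m n) l (r + \<epsilon>)} \<notin> I"
      by (elim exE conjE bexE)
    obtain k where k: "k \<in> {0<..<1}" "tnorm (1 - k) (1 - k) > 1 - l" "tconorm k k < l"
      using ex_radius l by auto
    have "y \<notin> rough_I2_LIM I \<mu> \<nu> r x" if y: "y \<in> ifns_ball \<mu> \<nu> \<xi> k (\<epsilon> / 2)" for y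
    proof
      assume "y \<in> rough_I2_LIM I \<mu> \<nu> r x"
      then have "{(m, n). y \<notin> ifns_ball \<mu> \<nu> (x m n) k (r + \<epsilon> / 2)} \<in> I"
        using \<epsilon> k(1) half_gt_zero[OF \<epsilon>]
        unfolding rough_I2_LIM_def rough_I2_convergent_iff_ball by blast
      moreover have "\<xi> \<in> ifns_ball \<mu> \<nu> (x m n) l (r + \<epsilon>)"
        if "y \<in> ifns_ball \<mu> \<nu> (x m n) k (r + \<epsilon> / 2)" for m n
        \<comment> \<open>The chain runs from \<open>x m n\<close> through \<open>y\<close> to
          \<xi>. Its second link needs \<xi> in the ball around \<open>y\<close>, which is the
          choice of \<open>y\<close> read through symmetry.\<close>
        using ifns_ball_trans[OF that _ _ _ k, of \<xi> "\<epsilon> / 2"] y \<epsilon> \<open>r \<ge> 0\<close>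
        by (simp add: ifns_ball_commute[of "\<epsilon> / 2" \<xi>] add.commute)
      ultimately have "{(m, n). \<xi> \<notin> ifns_ball \<mu> \<nu> (x m n) l (r + \<epsilon>)} \<in> I"
        \<comment> \<open>The contrapositive of the previous fact is the inclusion of exceptional
          sets.\<close>
        by (elim down) auto
      with notin show False ..
    qed
    then have "ifns_ball \<mu> \<nu> \<xi> k (\<epsilon> / 2) \<subseteq> - rough_I2_LIM I \<mu> \<nu> r x" by blast
    with k(1) \<epsilon> show ?thesis by (meson half_gt_zero)
  qed
  then show ?thesis
    by (simp add: closedin_def topspace_ifns_topology openin_ifns_topology ifns_open_def
        Compl_eq_Diff_UNIV[symmetric])
qed

end

theorem theorem3p3:
  fixes I :: "(nat \<times> nat) set set"
    and scale :: "'k::real_normed_field \<Rightarrow> 'a::real_normed_vector \<Rightarrow> 'a"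
    and \<mu> \<nu> :: "'a \<Rightarrow> real \<Rightarrow> real"
    and tnorm tconorm :: "real \<Rightarrow> real \<Rightarrow> real"
    and x :: "nat \<Rightarrow> nat \<Rightarrow> 'a"
  assumes "admissible_ideal I"
    and "ifns scale \<mu> \<nu> tnorm tconorm"
  shows "\<forall>r>0. closedin (ifns_topology \<mu> \<nu>) (rough_I2_LIM I \<mu> \<nu> r x)"
  using ifns.closedin_rough_I2_LIM[OF assms(2)] assms(1)
  by (auto simp: admissible_ideal_def)

end
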